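(* Let $\Delta\in\mathbb{C}^3\setminus\{(a,a,a)\mid a\in\mathbb{C}\}$ and let $\eta,\eta':\mathbb{R}/\mathbb{Z}\to\mathbb{C}$ be continuous functions (regarded as functions on $\mathbb{R}$ with period $1$). (i) The family $\{\mathcal{S}[\eta(t),\eta'(t)](\Delta)\}_t$ has a single tracing orbit in ascending order if and only if $$\eta(t+\tfrac13)=\eta(t)\,\omega^{-1},\qquad \eta'(t+\tfrac13)=\eta'(t)\,\omega\qquad(t\in\mathbb{R}),$$ and it has a single tracing orbit in descending order if and only if $$\eta(t-\tfrac13)=\eta(t)\,\omega^{-1},\qquad \eta'(t-\tfrac13)=\eta'(t)\,\omega\qquad(t\in\mathbb{R}).$$ (ii) Let $w,x,y,z\in\mathbb{Z}/3\mathbb{Z}$ with $y\neq z$, and put $\tilde\eta(t):=\eta(t)-\omega^{x-w}$, $\tilde\eta'(t):=\eta'(t)-\omega^{w-x}$. The family $\{\mathcal{M}^{wx/yz}[\eta(t),\eta'(t)](\Delta)\}_t$ has a single tracing orbit in ascending order if and only if $$\tilde\eta(t+\tfrac13)=\tilde\eta(t)\,\omega^{-1},\qquad \tilde\eta'(t+\tfrac13)=\tilde\eta'(t)\,\omega\qquad(t\in\mathbb{R}),$$ and it has a single tracing orbit in descending order if and only if $$\tilde\eta(t-\tfrac13)=\tilde\eta(t)\,\omega^{-1},\qquad \tilde\eta'(t-\tfrac13)=\tilde\eta'(t)\,\omega\qquad(t\in\mathbb{R}).$$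
   Context: Let $\omega=e^{2\pi i/3}$. A triangle triple is a vector $\Delta=(a_0,a_1,a_2)\in\mathbb{C}^3$, viewed as a column vector with coordinates indexed by $\mathbb{Z}/3\mathbb{Z}$; its centroid is $\frac13(a_0+a_1+a_2)$. Put $$J=\begin{pmatrix}0&1&0\\0&0&1\\1&0&0\end{pmatrix},\quad W=\begin{pmatrix}1&1&1\\1&\omega&\omega^2\\1&\omega^2&\omega\end{pmatrix}.$$ Generalized cevian operator: for $\eta,\eta'\in\mathbb{C}$, $\mathcal{S}[\eta,\eta']:=W\,\mathrm{diag}(1,\eta',\eta)\,W^{-1}\in M_3(\mathbb{C})$, acting on $\mathbb{C}^3$ on the left. It preserves centroids. Generalized median operator: for $\eta,\eta'\in\mathbb{C}$ and $w,x,y,z\in\mathbb{Z}/3\mathbb{Z}$ with $y\ne z$, and a triangle triple $\Delta=(a_0,a_1,a_2)$ with $\mathcal{S}[\eta,\eta'](\Delta)=(a_0',a_1',a_2')$, define $\mathcal{M}^{wx/yz}[\eta,\eta'](\Delta)=(a_0'',a_1'',a_2'')$ to be the unique triangle triple having the same centroid as $\Delta$ and satisfying $a'_{x+k}-a_{w+k}=a''_{z+k}-a''_{y+k}$ for all $k\in\mathbb{Z}/3\mathbb{Z}$. Single tracing orbit: a family $\{\Delta(t)\}_{t\in\mathbb{R}/\mathbb{Z}}$ of triangle triples is said to have a single tracing orbit in ascending (resp. descending) order if $J\,\Delta(t)=\Delta(t+\frac13)$ (resp. $J\,\Delta(t)=\Delta(t-\frac13)$) for all $t$.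
   Formalization: The "only if" directions in (i) and (ii) are proved only for Δ not equilateral (three side lengths not all equal); they fail for equilateral Δ, e.g. Δ=(1,ω,ω²), η=1, η'(t)=e^{2πit}. The "if" directions are proved for all non-constant Δ. *)

theory Defs
  imports "HOL-Analysis.Analysis"
begin

text \<open>
  The index type 3 is the ring of integers modulo 3, so that index arithmetic such as
  \<open>x + k\<close> is modulo 3.  The library function \<open>vector\<close> starts numbering at 1 and
  therefore does not match coordinates \<open>0, 1, 2\<close>; this constructor does.
\<close>

definition triple :: "'a \<Rightarrow> 'a \<Rightarrow> 'a \<Rightarrow> 'a ^ 3" where
  "triple a b c = (\<chi> i. if i = 0 then a else if i = 1 then b else c)"

definition omega :: complex where
  "omega = exp (2 * of_real pi * \<i> / 3)"

text \<open>Powers of \<open>omega\<close> with exponent modulo 3.\<close>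

definition omega_pow :: "3 \<Rightarrow> complex" where
  "omega_pow k = (if k = 0 then 1 else if k = 1 then omega else omega ^ 2)"

definition centroid :: "complex ^ 3 \<Rightarrow> complex" where
  "centroid \<Delta> = (\<Delta> $ 0 + \<Delta> $ 1 + \<Delta> $ 2) / 3"

definition J_mat :: "complex ^ 3 ^ 3" where
  "J_mat = triple (triple 0 1 0) (triple 0 0 1) (triple 1 0 0)"

definition W_mat :: "complex ^ 3 ^ 3" where
  "W_mat = triple (triple 1 1 1) (triple 1 omega (omega ^ 2)) (triple 1 (omega ^ 2) omega)"

definition diag3 :: "complex \<Rightarrow> complex \<Rightarrow> complex \<Rightarrow> complex ^ 3 ^ 3" where
  "diag3 a b c = triple (triple a 0 0) (triple 0 b 0) (triple 0 0 c)"

definition cevian_op :: "complex \<Rightarrow> complex \<Rightarrow> complex ^ 3 ^ 3" where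
  "cevian_op \<eta> \<eta>' = W_mat ** diag3 1 \<eta>' \<eta> ** matrix_inv W_mat"

text \<open>The description determines a unique triple only for \<open>y \<noteq> z\<close>.\<close>

definition median_op ::
  "3 \<Rightarrow> 3 \<Rightarrow> 3 \<Rightarrow> 3 \<Rightarrow> complex \<Rightarrow> complex \<Rightarrow> complex ^ 3 \<Rightarrow> complex ^ 3" where
  "median_op w x y z \<eta> \<eta>' \<Delta> =
    (THE \<Delta>''. centroid \<Delta>'' = centroid \<Delta> \<and>
       (\<forall>k. (cevian_op \<eta> \<eta>' *v \<Delta>) $ (x + k) - \<Delta> $ (w + k) = \<Delta>'' $ (z + k) - \<Delta>'' $ (y + k)))"

definition single_tracing_ascending :: "(real \<Rightarrow> complex ^ 3) \<Rightarrow> bool" where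
  "single_tracing_ascending F \<longleftrightarrow> (\<forall>t. J_mat *v F t = F (t + 1/3))"

definition single_tracing_descending :: "(real \<Rightarrow> complex ^ 3) \<Rightarrow> bool" where
  "single_tracing_descending F \<longleftrightarrow> (\<forall>t. J_mat *v F t = F (t - 1/3))"

definition shift_law :: "real \<Rightarrow> (real \<Rightarrow> complex) \<Rightarrow> (real \<Rightarrow> complex) \<Rightarrow> bool" where
  "shift_law s \<eta> \<eta>' \<longleftrightarrow>
    (\<forall>t. \<eta> (t + s) = \<eta> t * inverse omega) \<and> (\<forall>t. \<eta>' (t + s) = \<eta>' t * omega)"

text \<open>
  Equilateral triples, of either orientation, are the ones with
  \<open>a\<^sub>0 + \<omega> a\<^sub>1 + \<omega>\<^sup>2 a\<^sub>2 = 0\<close> or \<open>a\<^sub>0 + \<omega>\<^sup>2 a\<^sub>1 + \<omega> a\<^sub>2 = 0\<close>; constant triples are included.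
  For such a triple the cevian and median operators do not depend on one of the two parameters.
  For instance, for \<open>\<Delta> = (1, \<omega>, \<omega>\<^sup>2)\<close> one has \<open>cevian_op \<eta> \<eta>' *v \<Delta> = \<eta>' \<Delta>\<close>, so
  that a single tracing orbit gives no information about \<open>\<eta>\<close>.
\<close>

definition equilateral :: "complex ^ 3 \<Rightarrow> bool" where
  "equilateral \<Delta> \<longleftrightarrow>
    dist (\<Delta> $ 0) (\<Delta> $ 1) = dist (\<Delta> $ 1) (\<Delta> $ 2) \<and> dist (\<Delta> $ 1) (\<Delta> $ 2) = dist (\<Delta> $ 2) (\<Delta> $ 0)"

end

theory Submission imports Defs begin

text \<open>
  In Fourier coordinates \<open>\<Delta> = W (c\<^sub>0, c\<^sub>1, c\<^sub>2)\<close> all operators involved are diagonal: \<open>J\<close> multiplies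
  \<open>c\<^sub>1\<close> by \<open>\<omega>\<close> and \<open>c\<^sub>2\<close> by \<open>\<omega>\<^sup>-\<^sup>1\<close>, the cevian operator multiplies them by \<open>\<eta>'\<close> and \<open>\<eta>\<close>,
  and the median operator multiplies them by nonzero constants times \<open>\<eta>' - \<omega>\<^bsup>w-x\<^esup>\<close> and
  \<open>\<eta> - \<omega>\<^bsup>x-w\<^esup>\<close>.  A single tracing orbit therefore amounts to the shift laws, as soon
  as \<open>c\<^sub>1\<close> and \<open>c\<^sub>2\<close> can be cancelled; if one of them vanishes, the triple is equilateral.
\<close>

lemma three_cases:
  fixes k :: 3
  obtains "k = 0" | "k = 1" | "k = 2"
  using exhaust_3[of k] by auto

text \<open>The simplifier decides these equations but does not use them to rewrite subterms.\<close>

lemma numeral_mod_3 [simp]: "(3::3) = 0" "(4::3) = 1" "(- 1::3) = 2" "(- 2::3) = 1"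
  by simp_all

lemma omega_cube: "omega ^ 3 = 1"
  using exp_two_pi_i by (simp add: omega_def mult_ac flip: exp_of_nat_mult)

lemma omega_neq_1: "omega \<noteq> 1"
proof
  assume "omega = 1"
  then have "cos (2 * pi / 3) = 1"
    using Re_exp[of "2 * of_real pi * \<i> / 3"] by (simp add: omega_def)
  then show False
    unfolding cos_120 by simp
qed

lemma omega_squared: "omega ^ 2 = - 1 - omega"
proof -
  have "(omega - 1) * (omega ^ 2 + omega + 1) = omega ^ 3 - 1"
    by (simp add: algebra_simps power2_eq_square power3_eq_cube)
  then have "omega ^ 2 + omega + 1 = 0"
    using omega_neq_1 by (simp add: omega_cube)
  then show ?thesis
    by (simp add: algebra_simps eq_neg_iff_add_eq_0)
qed

lemma omega_nonzero [simp]: "omega \<noteq> 0"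
  by (simp add: omega_def)

lemma norm_omega [simp]: "norm omega = 1"
  by (simp add: omega_def norm_exp_eq_Re)

lemma inverse_omega: "inverse omega = omega ^ 2"
  using omega_cube by (simp add: field_simps power2_eq_square power3_eq_cube)

lemma omega_pow_0 [simp]: "omega_pow 0 = 1"
  by (simp add: omega_pow_def)

lemma omega_pow_1 [simp]: "omega_pow 1 = omega"
  by (simp add: omega_pow_def)

lemma omega_pow_2 [simp]: "omega_pow 2 = omega ^ 2"
  by (simp add: omega_pow_def)

lemma omega_pow_add: "omega_pow (j + k) = omega_pow j * omega_pow k"
proof -
  have "omega * omega ^ 2 = 1" "omega ^ 2 * omega = 1" "omega ^ 2 * omega ^ 2 = omega"
    using omega_cube by (simp_all add: power2_eq_square power3_eq_cube algebra_simps)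
  then show ?thesis
    by (cases j rule: three_cases; cases k rule: three_cases) (simp_all add: power2_eq_square)
qed

lemma omega_pow_nonzero [simp]: "omega_pow k \<noteq> 0"
  by (simp add: omega_pow_def)

lemma norm_omega_pow [simp]: "norm (omega_pow k) = 1"
  by (simp add: omega_pow_def norm_power)

lemma omega_pow_eq_1_iff: "omega_pow k = 1 \<longleftrightarrow> k = 0"
proof -
  have "omega ^ 2 \<noteq> 1"
    using omega_neq_1 inverse_omega by (metis inverse_eq_1_iff)
  then show ?thesis
    using omega_neq_1 by (simp add: omega_pow_def)
qed

lemma omega_pow_eq_iff: "omega_pow j = omega_pow k \<longleftrightarrow> j = k"
  using omega_pow_add[of "j - k" k] by (auto simp: omega_pow_eq_1_iff)

lemma triple_nth [simp]:
  "triple a b c $ 0 = a" "triple a b c $ 1 = b" "triple a b c $ 2 = c"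
  by (simp_all add: triple_def)

lemma sum_UNIV_3: "sum f (UNIV :: 3 set) = f 0 + f 1 + f 2"
  by (simp add: sum_3 ac_simps)

lemma triple_eqI:
  fixes u v :: "'a ^ 3"
  assumes "u $ 0 = v $ 0" "u $ 1 = v $ 1" "u $ 2 = v $ 2"
  shows "u = v"
  unfolding vec_eq_iff
proof
  show "u $ k = v $ k" for k
    using assms by (cases k rule: three_cases) simp_all
qed

text \<open>These are the characters of the cyclic group of order 3, extended to all indices: the
  third column of \<open>W_mat\<close> is \<open>omega_pow (- k)\<close> because
  \<open>2 * k = - k\<close> modulo 3. In this form an index shift becomes a scalar factor.\<close>

definition fourier :: "complex \<Rightarrow> complex \<Rightarrow> complex \<Rightarrow> complex ^ 3" where
  "fourier c0 c1 c2 = (\<chi> k. c0 + c1 * omega_pow k + c2 * omega_pow (- k))"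

lemma fourier_nth: "fourier c0 c1 c2 $ k = c0 + c1 * omega_pow k + c2 * omega_pow (- k)"
  by (simp add: fourier_def)

lemma W_mat_mult: "W_mat *v triple c0 c1 c2 = fourier c0 c1 c2"
  by (rule triple_eqI)
    (simp_all add: W_mat_def matrix_vector_mult_def sum_UNIV_3 fourier_nth mult.commute)

lemma diag3_mult: "diag3 a b c *v triple u v w = triple (a * u) (b * v) (c * w)"
  by (rule triple_eqI) (simp_all add: diag3_def matrix_vector_mult_def sum_UNIV_3)

lemma J_mat_mult: "J_mat *v fourier c0 c1 c2 = fourier c0 (c1 * omega) (c2 * inverse omega)"
proof -
  have nth: "(J_mat *v v) $ k = v $ (k + 1)" for v k
    by (cases k rule: three_cases)
      (simp_all add: J_mat_def matrix_vector_mult_def sum_UNIV_3)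
  \<comment> \<open>The exponent \<open>2 - k\<close> is \<open>- (k + 1)\<close> modulo 3.\<close>
  have "omega_pow (k + 1) = omega * omega_pow k"
    "omega_pow (2 - k) = inverse omega * omega_pow (- k)" for k
    using omega_pow_add[of k 1] omega_pow_add[of "- k" 2]
    by (simp_all add: inverse_omega mult.commute)
  then show ?thesis
    by (simp add: vec_eq_iff nth fourier_nth)
qed

lemma fourier_surj:
  obtains c0 c1 c2 where "v = fourier c0 c1 c2"
proof
  define a b c where "a = v $ 0" "b = v $ 1" "c = v $ 2"
  \<comment> \<open>Reduction to degree at most one in \<open>omega\<close>; the second equation
    catches right-nested products.\<close>
  have ww: "omega * omega = - 1 - omega" "omega * (omega * z) = (- 1 - omega) * z" for z
    using omega_squared by (simp_all add: power2_eq_square flip: mult.assoc)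
  \<comment> \<open>The witnesses are the inverse discrete Fourier transform, with
    \<open>omega ^ 2\<close> as the inverse of \<open>omega\<close>.\<close>
  show "v = fourier ((a + b + c) / 3) ((a + omega ^ 2 * b + omega * c) / 3)
      ((a + omega * b + omega ^ 2 * c) / 3)"
    by (rule triple_eqI)
      (simp_all add: fourier_nth omega_squared ww field_simps flip: a_b_c_def)
qed

text \<open>A surjective square matrix is invertible, so \<open>fourier_surj\<close> makes an
  explicit inverse unnecessary.\<close>

lemma matrix_inv_W_mat: "matrix_inv W_mat *v fourier c0 c1 c2 = triple c0 c1 c2"
proof -
  have "surj ((*v) W_mat)"
    by (metis W_mat_mult fourier_surj surj_def)
  then have "invertible W_mat"
    by (simp add: invertible_right_inverse matrix_right_invertible_surjective)
  then have "matrix_inv W_mat ** W_mat = mat 1"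
    unfolding invertible_def matrix_inv_def by (rule someI2_ex) simp
  then show ?thesis
    by (simp add: matrix_vector_mul_assoc flip: W_mat_mult)
qed

lemma fourier_eq_iff:
  "fourier c0 c1 c2 = fourier d0 d1 d2 \<longleftrightarrow> c0 = d0 \<and> c1 = d1 \<and> c2 = d2"
  by (metis matrix_inv_W_mat triple_nth)

lemma cevian_op_fourier:
  "cevian_op \<eta> \<eta>' *v fourier c0 c1 c2 = fourier c0 (c1 * \<eta>') (c2 * \<eta>)"
  by (simp add: cevian_op_def matrix_inv_W_mat diag3_mult W_mat_mult mult.commute
      flip: matrix_vector_mul_assoc)

lemma centroid_fourier [simp]: "centroid (fourier c0 c1 c2) = c0"
  by (simp add: centroid_def fourier_nth omega_squared right_diff_distrib)

text \<open>Comparing Fourier coefficients splits the defining equations into one linear equation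
  for each of the two nonconstant coefficients. Since \<open>y \<noteq> z\<close>, the factors to
  divide by are nonzero.\<close>

lemma median_op_fourier:
  assumes "y \<noteq> z"
  shows "median_op w x y z \<eta> \<eta>' (fourier c0 c1 c2) =
    fourier c0 (c1 * omega_pow x / (omega_pow z - omega_pow y) * (\<eta>' - omega_pow (w - x)))
      (c2 * omega_pow (- x) / (omega_pow (- z) - omega_pow (- y)) * (\<eta> - omega_pow (x - w)))"
    (is "_ = fourier c0 ?e1 ?e2")
proof -
  have nz: "omega_pow z - omega_pow y \<noteq> 0" "omega_pow (- z) - omega_pow (- y) \<noteq> 0"
    using assms by (auto simp: omega_pow_eq_iff)
  \<comment> \<open>Taking \<open>omega_pow x\<close> and \<open>omega_pow (- x)\<close> out of the
    numerators produces the constants subtracted from \<open>\<eta>'\<close> and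
    \<open>\<eta>\<close>.\<close>
  have w: "omega_pow w = omega_pow x * omega_pow (w - x)"
    "omega_pow (- w) = omega_pow (- x) * omega_pow (x - w)"
    by (simp_all flip: omega_pow_add)
  have diff: "fourier a0 a1 a2 $ (i + k) - fourier b0 b1 b2 $ (j + k) =
      fourier (a0 - b0) (a1 * omega_pow i - b1 * omega_pow j)
        (a2 * omega_pow (- i) - b2 * omega_pow (- j)) $ k" for a0 a1 a2 b0 b1 b2 i j k
    using omega_pow_add[of "- i" "- k"] omega_pow_add[of "- j" "- k"]
    by (simp add: fourier_nth omega_pow_add algebra_simps)
  \<comment> \<open>With equal centroids the constant coefficient is 0 on both sides.\<close>
  have iff: "(\<forall>k. (cevian_op \<eta> \<eta>' *v fourier c0 c1 c2) $ (x + k) - fourier c0 c1 c2 $ (w + k) =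
        fourier c0 d1 d2 $ (z + k) - fourier c0 d1 d2 $ (y + k)) \<longleftrightarrow> d1 = ?e1 \<and> d2 = ?e2"
    for d1 d2
    using nz
    by (simp add: cevian_op_fourier diff fourier_eq_iff w flip: vec_eq_iff)
      (auto simp: field_simps)
  show ?thesis
    unfolding median_op_def
  proof (rule the_equality)
    show "centroid (fourier c0 ?e1 ?e2) = centroid (fourier c0 c1 c2) \<and>
      (\<forall>k. (cevian_op \<eta> \<eta>' *v fourier c0 c1 c2) $ (x + k) - fourier c0 c1 c2 $ (w + k) =
        fourier c0 ?e1 ?e2 $ (z + k) - fourier c0 ?e1 ?e2 $ (y + k))"
      unfolding iff by simp
  next
    fix v
    assume v: "centroid v = centroid (fourier c0 c1 c2) \<and>
      (\<forall>k. (cevian_op \<eta> \<eta>' *v fourier c0 c1 c2) $ (x + k) - fourier c0 c1 c2 $ (w + k) =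
        v $ (z + k) - v $ (y + k))"
    obtain d0 d1 d2 where d: "v = fourier d0 d1 d2"
      by (rule fourier_surj)
    with v have "d0 = c0" by simp
    with v d iff[of d1 d2] show "v = fourier c0 ?e1 ?e2" by simp
  qed
qed

text \<open>With only one nonconstant term left, passing to the next side multiplies the difference
  of endpoints by a number of modulus 1, so all sides have equal length.\<close>

lemma equilateral_fourier:
  assumes "c1 = 0 \<or> c2 = 0"
  shows "equilateral (fourier c0 c1 c2)"
proof -
  have step: "dist (fourier c0 c1 c2 $ k) (fourier c0 c1 c2 $ (k + 1)) =
      (if c1 = 0 then norm (c2 * (1 - omega_pow (- 1))) else norm (c1 * (1 - omega)))" for k
  proof -
    have "fourier c0 c1 c2 $ k - fourier c0 c1 c2 $ (k + 1) =
      c1 * (1 - omega) * omega_pow k + c2 * (1 - omega_pow (- 1)) * omega_pow (- k)"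
      using omega_pow_add[of "- k" "- 1"]
      by (simp add: fourier_nth omega_pow_add algebra_simps)
    then show ?thesis
      using assms by (auto simp: dist_norm norm_mult)
  qed
  show ?thesis
    using step[of 0] step[of 1] step[of 2] by (simp add: equilateral_def)
qed

text \<open>By uniqueness of Fourier coefficients the orbit equation is the shift law multiplied by
  \<open>p\<close> and \<open>q\<close>; the converse cancels them.\<close>

lemma J_mat_shift_law:
  fixes \<theta> \<theta>' :: "real \<Rightarrow> complex"
  assumes "F = (\<lambda>t. fourier c0 (p * \<theta>' t) (q * \<theta> t))"
  shows "shift_law s \<theta> \<theta>' \<Longrightarrow> \<forall>t. J_mat *v F t = F (t + s)"
    and "p \<noteq> 0 \<Longrightarrow> q \<noteq> 0 \<Longrightarrow> (\<forall>t. J_mat *v F t = F (t + s)) \<longleftrightarrow> shift_law s \<theta> \<theta>'"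
  by (auto simp: assms shift_law_def J_mat_mult fourier_eq_iff mult.assoc)

text \<open>Common form of both parts of the theorem, with \<open>equilateral \<Delta>\<close> for
  \<open>P\<close>.\<close>

lemma single_tracing_fourier:
  assumes F: "F = (\<lambda>t. fourier c0 (p * \<theta>' t) (q * \<theta> t))"
    and nz: "\<not> P \<Longrightarrow> p \<noteq> 0 \<and> q \<noteq> 0"
  shows "(shift_law (1/3) \<theta> \<theta>' \<longrightarrow> single_tracing_ascending F) \<and>
      (\<not> P \<longrightarrow> (single_tracing_ascending F \<longleftrightarrow> shift_law (1/3) \<theta> \<theta>')) \<and>
      (shift_law (-1/3) \<theta> \<theta>' \<longrightarrow> single_tracing_descending F) \<and>
      (\<not> P \<longrightarrow> (single_tracing_descending F \<longleftrightarrow> shift_law (-1/3) \<theta> \<theta>'))"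
proof -
  have "single_tracing_descending F \<longleftrightarrow> (\<forall>t. J_mat *v F t = F (t + -1/3))"
    by (simp add: single_tracing_descending_def)
  then show ?thesis
    unfolding single_tracing_ascending_def
    using J_mat_shift_law[OF F] nz by metis
qed

theorem proposition6p3:
  fixes \<Delta> :: "complex ^ 3" and \<eta> \<eta>' :: "real \<Rightarrow> complex"
  assumes "\<Delta> \<notin> {triple a a a | a. True}"
    and "continuous_on UNIV \<eta>" and "\<forall>t. \<eta> (t + 1) = \<eta> t"
    and "continuous_on UNIV \<eta>'" and "\<forall>t. \<eta>' (t + 1) = \<eta>' t"
  shows
   "(let F = (\<lambda>t. cevian_op (\<eta> t) (\<eta>' t) *v \<Delta>) in
      (shift_law (1/3) \<eta> \<eta>' \<longrightarrow> single_tracing_ascending F) \<and>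
      (\<not> equilateral \<Delta> \<longrightarrow> (single_tracing_ascending F \<longleftrightarrow> shift_law (1/3) \<eta> \<eta>')) \<and>
      (shift_law (-1/3) \<eta> \<eta>' \<longrightarrow> single_tracing_descending F) \<and>
      (\<not> equilateral \<Delta> \<longrightarrow> (single_tracing_descending F \<longleftrightarrow> shift_law (-1/3) \<eta> \<eta>'))) \<and>
    (\<forall>w x y z. y \<noteq> z \<longrightarrow>
     (let F = (\<lambda>t. median_op w x y z (\<eta> t) (\<eta>' t) \<Delta>);
          \<theta> = (\<lambda>t. \<eta> t - omega_pow (x - w));
          \<theta>' = (\<lambda>t. \<eta>' t - omega_pow (w - x)) in
      (shift_law (1/3) \<theta> \<theta>' \<longrightarrow> single_tracing_ascending F) \<and>
      (\<not> equilateral \<Delta> \<longrightarrow> (single_tracing_ascending F \<longleftrightarrow> shift_law (1/3) \<theta> \<theta>')) \<and>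
      (shift_law (-1/3) \<theta> \<theta>' \<longrightarrow> single_tracing_descending F) \<and>
      (\<not> equilateral \<Delta> \<longrightarrow> (single_tracing_descending F \<longleftrightarrow> shift_law (-1/3) \<theta> \<theta>'))))"
proof -
  obtain c0 c1 c2 where \<Delta>: "\<Delta> = fourier c0 c1 c2"
    by (rule fourier_surj)
  have nz: "c1 \<noteq> 0 \<and> c2 \<noteq> 0" if "\<not> equilateral \<Delta>"
    using that equilateral_fourier \<Delta> by blast
  have cevian: "(\<lambda>t. cevian_op (\<eta> t) (\<eta>' t) *v \<Delta>) = (\<lambda>t. fourier c0 (c1 * \<eta>' t) (c2 * \<eta> t))"
    by (simp add: \<Delta> cevian_op_fourier)
  have median: "(\<lambda>t. median_op w x y z (\<eta> t) (\<eta>' t) \<Delta>) =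
      (\<lambda>t. fourier c0
        (c1 * omega_pow x / (omega_pow z - omega_pow y) * (\<eta>' t - omega_pow (w - x)))
        (c2 * omega_pow (- x) / (omega_pow (- z) - omega_pow (- y)) * (\<eta> t - omega_pow (x - w))))"
    if "y \<noteq> z" for w x y z
    by (simp add: \<Delta> median_op_fourier[OF that])
  have median_nz: "c1 * omega_pow x / (omega_pow z - omega_pow y) \<noteq> 0 \<and>
      c2 * omega_pow (- x) / (omega_pow (- z) - omega_pow (- y)) \<noteq> 0"
    if "\<not> equilateral \<Delta>" "y \<noteq> z" for x y z
    using nz that by (auto simp: omega_pow_eq_iff)
  show ?thesis
    unfolding Let_def
    using single_tracing_fourier[OF cevian nz] single_tracing_fourier[OF median median_nz]
    \<comment> \<open>The composed rule matches only the outermost conjunction, so the four claims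
      about each operator stay together and match the two facts.\<close>
    by (intro conjI[OF _ allI[OF allI[OF allI[OF allI[OF impI]]]]])
qed

end
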